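(* For every optimal prefix-free machine $V$, there exists an optimal prefix-free machine $W$ for which the following conditions (i), (ii), and (iii) hold: (i) $H_W(s)=H_V(s)$ for every $s\in\{0,1\}^*$. (ii) $W^{-1}(s)$ is a finite set for every $s\in\{0,1\}^*$. (iii) Moreover, there exists a total recursive function $f\colon \{0,1\}^*\to \mathbb{N}^+$ such that $\#W^{-1}(s)\le f(s)$ for every $s\in\{0,1\}^*$.
   Context: $\{0,1\}^*$ is the set of finite binary strings (including the empty string), and $|p|$ is the length of a string $p$. $\mathbb{N}=\{0,1,2,\dots\}$ and $\mathbb{N}^+$ is the set of positive integers. $\#S$ is the cardinality of a set $S$, and $\operatorname{dom} f$ is the domain of definition of a (partial) function $f$. A subset of $\{0,1\}^*$ is prefix-free if no string in it is a prefix of another string in it. A prefix-free machine is a partial recursive function $C\colon\{0,1\}^*\to\{0,1\}^*$ such that $\operatorname{dom} C$ is a prefix-free set. For a prefix-free machine $C$ and $s\in\{0,1\}^*$, $C^{-1}(s)=\{\,p\in\operatorname{dom} C\mid C(p)=s\,\}$ and $H_C(s)=\min\{\,|p| \mid p\in\{0,1\}^*,\ C(p)=s\,\}$, with $H_C(s)=\infty$ if no such $p$ exists. A prefix-free machine $V$ is optimal if for each prefix-free machine $C$ there exists $d\in\mathbb{N}$ such that for every $p\in\operatorname{dom} C$ there is $q$ with $V(q)=C(p)$ and $|q|\le|p|+d$; equivalently, for each prefix-free machine $C$ there exists $d\in\mathbb{N}$ such that $H_V(s)\le H_C(s)+d$ for every $s\in\{0,1\}^*$. *)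

theory Defs
  imports Main "HOL-Library.Sublist" "HOL-Library.Extended_Nat"
begin

text \<open>Kleene's mu-recursive functions.  Terms carry no arity annotation: a term denotes a
  partial function of each arity, undefined where the argument list is too short (or, for
  \<open>Succ\<close>, not of length one).  \<open>Zero\<close> is the constant function of every arity.\<close>

datatype recf =
    Zero
  | Succ
  | Proj nat
  | Comp recf "recf list"
  | PrimRec recf recf
  | Mu recf

fun recf_eval :: "recf \<Rightarrow> nat list \<rightharpoonup> nat" where
  "recf_eval Zero xs = Some 0"
| "recf_eval Succ xs = (case xs of [x] \<Rightarrow> Some (Suc x) | _ \<Rightarrow> None)"
| "recf_eval (Proj i) xs = (if i < length xs then Some (xs ! i) else None)"
| "recf_eval (Comp f gs) xs =
     (if \<forall>g\<in>set gs. recf_eval g xs \<noteq> None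
      then recf_eval f (map (\<lambda>g. the (recf_eval g xs)) gs) else None)"
| "recf_eval (PrimRec f g) xs =
     (case xs of [] \<Rightarrow> None
      | n # ys \<Rightarrow> rec_nat (recf_eval f ys)
                    (\<lambda>m r. Option.bind r (\<lambda>y. recf_eval g (m # y # ys))) n)"
| "recf_eval (Mu f) xs =
     (let least_zero = (\<lambda>n. recf_eval f (n # xs) = Some 0 \<and>
                            (\<forall>m<n. \<exists>y>0. recf_eval f (m # xs) = Some y))
      in if \<exists>n. least_zero n then Some (THE n. least_zero n) else None)"

text \<open>Strings are identified with numbers through the length-lexicographic enumeration
  \<open>[], 0, 1, 00, 01, 10, 11, 000, \<dots>\<close> (with \<open>False\<close> for 0 and \<open>True\<close> for 1).\<close>

type_synonym bitstring = "bool list"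

definition str_code :: "bitstring \<Rightarrow> nat" where
  "str_code s = foldl (\<lambda>n b. 2 * n + (if b then 2 else 1)) 0 s"

lemma str_code_simps [simp]:
  "str_code [] = 0"
  "str_code (s @ [b]) = 2 * str_code s + (if b then 2 else 1)"
  by (simp_all add: str_code_def)

lemma bij_str_code: "bij str_code"
proof (rule bijI)
  show "inj str_code"
  proof (rule injI)
    fix s t show "str_code s = str_code t \<Longrightarrow> s = t"
    proof (induction s arbitrary: t rule: rev_induct)
      case Nil
      then show ?case by (cases t rule: rev_cases) (auto split: if_splits)
    next
      case (snoc b s)
      show ?case
      proof (cases t rule: rev_cases)
        case Nil
        with snoc.prems show ?thesis by (auto split: if_splits)
      next
        case (snoc t' c)
        have eq: "2 * str_code s + (if b then 2 else 1) = 2 * str_code t' + (if c then 2 else 1)"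
          using snoc.prems snoc by simp
        then have "b = c" by (cases b; cases c; simp; presburger)
        with eq snoc.IH[of t'] snoc show ?thesis by simp
      qed
    qed
  qed
  have "\<exists>s. str_code s = n" for n
  proof (induction n rule: less_induct)
    case (less n)
    show ?case
    proof (cases "n = 0")
      case True
      then show ?thesis by (intro exI[of _ "[]"]) simp
    next
      case False
      then have "(n - 1) div 2 < n" by linarith
      then obtain s where s: "str_code s = (n - 1) div 2"
        using less by blast
      have "str_code (s @ [even n]) = n"
        using s False by (simp; presburger)
      then show ?thesis ..
    qed
  qed
  then show "surj str_code" by (metis surj_def)
qed

definition partial_recursive :: "(bitstring \<rightharpoonup> bitstring) \<Rightarrow> bool" where
  "partial_recursive C \<longleftrightarrow>
     (\<exists>r. \<forall>p. recf_eval r [str_code p] = map_option str_code (C p))"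

definition total_recursive :: "(bitstring \<Rightarrow> nat) \<Rightarrow> bool" where
  "total_recursive f \<longleftrightarrow> (\<exists>r. \<forall>s. recf_eval r [str_code s] = Some (f s))"

definition prefix_free :: "bitstring set \<Rightarrow> bool" where
  "prefix_free S \<longleftrightarrow> (\<forall>p\<in>S. \<forall>q\<in>S. p \<noteq> q \<longrightarrow> \<not> prefix p q)"

definition prefix_free_machine :: "(bitstring \<rightharpoonup> bitstring) \<Rightarrow> bool" where
  "prefix_free_machine C \<longleftrightarrow> partial_recursive C \<and> prefix_free (dom C)"

definition programs :: "(bitstring \<rightharpoonup> bitstring) \<Rightarrow> bitstring \<Rightarrow> bitstring set" where
  "programs C s = {p \<in> dom C. C p = Some s}"

text \<open>On \<open>enat\<close>, the infimum of a nonempty set is its minimum and the infimum of the empty set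
  is \<open>\<infinity>\<close>.\<close>

definition complexity :: "(bitstring \<rightharpoonup> bitstring) \<Rightarrow> bitstring \<Rightarrow> enat" where
  "complexity C s = Inf {enat (length p) |p. C p = Some s}"

definition optimal :: "(bitstring \<rightharpoonup> bitstring) \<Rightarrow> bool" where
  "optimal V \<longleftrightarrow> prefix_free_machine V \<and>
     (\<forall>C. prefix_free_machine C \<longrightarrow>
        (\<exists>d. \<forall>p\<in>dom C. \<exists>q. V q = C p \<and> length q \<le> length p + d))"

end

(* The machine C with C(0^n 1) = (the n-th string) is prefix-free, so optimality of V yields a
   constant d such that every s, the n-th string say, has a V-program of length at most
   n + 1 + d.  Let W be the restriction of V to those p whose code is at most 2^(n + d + 2),
   n being the code of V(p).  All strings of length at most n + 1 + d satisfy this bound, so W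
   keeps every shortest program, and the number of W-programs of s is at most the number of
   codes up to the bound, which is a recursive function of s. *)

theory Submission
  imports Defs
begin

definition add_recf :: recf where
  "add_recf = PrimRec (Proj 0) (Comp Succ [Proj 1])"

lemma add_recf: "recf_eval add_recf [m, n] = Some (m + n)"
  unfolding add_recf_def by (induction m) auto

definition pow2_recf :: recf where
  "pow2_recf = PrimRec (Comp Succ [Zero]) (Comp add_recf [Proj 1, Proj 1])"

lemma pow2_recf: "recf_eval pow2_recf [n] = Some (2 ^ n)"
  unfolding pow2_recf_def by (induction n) (auto simp: add_recf)

definition pred_recf :: recf where
  "pred_recf = PrimRec Zero (Proj 0)"

lemma pred_recf: "recf_eval pred_recf [n] = Some (n - 1)"
  unfolding pred_recf_def by (induction n) auto

text \<open>The recursion runs on the first argument, which is therefore the number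
  subtracted.\<close>

definition monus_recf :: recf where
  "monus_recf = PrimRec (Proj 0) (Comp pred_recf [Proj 1])"

lemma monus_recf: "recf_eval monus_recf [m, n] = Some (n - m)"
  unfolding monus_recf_def by (induction m) (auto simp: pred_recf)

text \<open>An equality test suited to \<open>Mu\<close>: the value is 0 exactly when the two
  arguments agree.\<close>

definition dist_recf :: recf where
  "dist_recf = Comp add_recf [monus_recf, Comp monus_recf [Proj 1, Proj 0]]"

lemma dist_recf: "recf_eval dist_recf [m, n] = Some ((n - m) + (m - n))"
  by (simp add: dist_recf_def add_recf monus_recf)

fun shift_recf :: "nat \<Rightarrow> recf" where
  "shift_recf 0 = Proj 0"
| "shift_recf (Suc k) = Comp Succ [shift_recf k]"

lemma shift_recf: "recf_eval (shift_recf k) (n # ns) = Some (n + k)"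
  by (induction k) auto

definition pow2_shift_recf :: "nat \<Rightarrow> recf" where
  "pow2_shift_recf k = Comp pow2_recf [shift_recf k]"

lemma pow2_shift_recf: "recf_eval (pow2_shift_recf k) (n # ns) = Some (2 ^ (n + k))"
  by (simp add: pow2_shift_recf_def shift_recf pow2_recf)

lemma total_recursive_Suc_pow2: "total_recursive (\<lambda>s. Suc (2 ^ (str_code s + k)))"
  unfolding total_recursive_def
  by (rule exI[of _ "Comp Succ [pow2_shift_recf k]"]) (simp add: pow2_shift_recf)

text \<open>\<^term>\<open>Mu (Proj 1)\<close> turns a nonzero argument into divergence.\<close>

lemma Mu_Proj_1: "recf_eval (Mu (Proj (Suc 0))) [z] = (if z = 0 then Some 0 else None)"
proof (cases "z = 0")
  case True
  \<comment> \<open>For \<open>z = 0\<close> every candidate is a zero, so only this is left of the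
    description of the least one.\<close>
  then have "(THE n::nat. \<forall>m. \<not> m < n) = 0"
    by (intro the_equality) auto
  with True show ?thesis by (auto simp: Let_def)
qed (simp add: Let_def)

lemma partial_recursive_restrict_pow2:
  assumes "partial_recursive V"
  shows "partial_recursive (\<lambda>p. case V p of None \<Rightarrow> None
           | Some s \<Rightarrow> if str_code p \<le> 2 ^ (str_code s + k) then Some s else None)"
proof -
  obtain r where r: "\<And>p. recf_eval r [str_code p] = map_option str_code (V p)"
    using assms unfolding partial_recursive_def by blast
  \<comment> \<open>The truncated difference is 0 exactly when the bound holds; otherwise
    \<open>Mu\<close> diverges. As \<open>Comp\<close> is strict,
    \<open>Comp (Proj 0) [r, ?g]\<close> returns the value of \<open>r\<close> only where this guard
    converges.\<close>
  let ?g = "Comp (Mu (Proj 1)) [Comp monus_recf [Comp (pow2_shift_recf k) [r], Proj 0]]"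
  have "recf_eval (Comp (Proj 0) [r, ?g]) [str_code p] = map_option str_code
      (case V p of None \<Rightarrow> None
       | Some s \<Rightarrow> if str_code p \<le> 2 ^ (str_code s + k) then Some s else None)" for p
    by (cases "V p")
      (simp_all add: r monus_recf pow2_shift_recf Mu_Proj_1 del: recf_eval.simps(6))
  then show ?thesis unfolding partial_recursive_def by blast
qed

text \<open>A block of n zeros has code 2^n - 1; appending a one doubles this and adds 2.
  Recognising a unary program thus becomes a search for an exponent.\<close>

lemma str_code_unary: "str_code (replicate n False @ [True]) = 2 ^ Suc n"
proof -
  have "Suc (str_code (replicate n False)) = 2 ^ n"
    by (induction n) (simp_all flip: replicate_append_same)
  then show ?thesis by simp
qed

text \<open>The \<open>Suc\<close> on the left strengthens the bound enough for the induction: a new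
  bit doubles the code and adds up to 2.\<close>

lemma str_code_less: "Suc (str_code p) < 2 ^ Suc (length p)"
  by (induction p rule: rev_induct) auto

lemma str_code_inv: "str_code (inv str_code n) = n"
  by (simp add: bij_str_code bij_is_surj surj_f_inv_f)

lemma str_code_eq_iff: "str_code p = str_code q \<longleftrightarrow> p = q"
  by (simp add: bij_str_code bij_is_inj inj_eq)

definition unary_machine :: "bitstring \<rightharpoonup> bitstring" where
  "unary_machine p = (if \<exists>n. p = replicate n False @ [True]
     then Some (inv str_code (length p - 1)) else None)"

lemma unary_machine_unary: "unary_machine (replicate (str_code s) False @ [True]) = Some s"
  by (auto simp: unary_machine_def bij_str_code bij_is_inj)

lemma unary_machine_prefix_free_machine: "prefix_free_machine unary_machine"
proof -
  \<comment> \<open>On \<open>[n, str_code p]\<close> this is the distance between 2^(n + 1) and the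
    code of \<open>p\<close>, so minimising over \<open>n\<close> both tests membership in the
    domain and finds the exponent.\<close>
  let ?D = "Comp dist_recf [pow2_shift_recf 1, Proj 1]"
  have D: "recf_eval ?D [n, str_code p] = Some (str_code p - 2 ^ Suc n + (2 ^ Suc n - str_code p))"
    for n p
    by (simp add: dist_recf pow2_shift_recf)
  have D0: "recf_eval ?D [n, str_code p] = Some 0 \<longleftrightarrow> p = replicate n False @ [True]" for n p
  proof -
    have "recf_eval ?D [n, str_code p] = Some 0 \<longleftrightarrow> str_code p = 2 ^ Suc n"
      by (simp only: D) auto
    then show ?thesis using str_code_unary str_code_eq_iff by metis
  qed
  \<comment> \<open>\<open>Mu\<close> also demands defined, positive values below the zero:
    \<open>?D\<close> is total, and comparing lengths excludes a second zero.\<close>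
  have Dpos: "\<exists>y>0. recf_eval ?D [m, str_code p] = Some y"
    if "p = replicate n False @ [True]" "m < n" for m n p
  proof -
    have "recf_eval ?D [m, str_code p] \<noteq> Some 0"
      using that by (auto simp only: D0 dest!: arg_cong[where f = length]) simp
    then show ?thesis by (simp only: D) auto
  qed
  have zero_iff: "recf_eval ?D [n, str_code p] = Some 0 \<and>
      (\<forall>m<n. \<exists>y>0. recf_eval ?D [m, str_code p] = Some y) \<longleftrightarrow> p = replicate n False @ [True]"
    for n p
    using D0 Dpos by blast
  have the_n: "(THE n. p = replicate n False @ [True]) = length p - 1"
    if "p = replicate m False @ [True]" for p m
    using that by (intro the_equality) auto
  \<comment> \<open>The zero found is already the code of the output
    \<open>inv str_code n\<close>.\<close>
  have "recf_eval (Mu ?D) [str_code p] = map_option str_code (unary_machine p)" for p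
    unfolding recf_eval.simps(6) Let_def zero_iff unary_machine_def
    using the_n[of p] by (auto simp: str_code_inv)
  then have "partial_recursive unary_machine"
    unfolding partial_recursive_def by blast
  moreover have "prefix_free (dom unary_machine)"
    unfolding prefix_free_def
  proof (intro ballI impI notI)
    fix p q
    assume dom: "p \<in> dom unary_machine" "q \<in> dom unary_machine"
      and neq: "p \<noteq> q" and "prefix p q"
    have "\<exists>n. x = replicate n False @ [True]" if "x \<in> dom unary_machine" for x
      using that by (simp add: unary_machine_def dom_def split: if_splits)
    with dom obtain m n where p: "p = replicate m False @ [True]"
      and q: "q = replicate n False @ [True]"
      by metis
    obtain r where r: "q = p @ r" using \<open>prefix p q\<close> by (rule prefixE)
    have "m \<le> n" using arg_cong[OF r, of length] by (simp add: p q)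
    \<comment> \<open>The final one of \<open>p\<close> sits at position \<open>m\<close> of
      \<open>q\<close>, whose only one is at position \<open>n\<close>.\<close>
    moreover have "q ! m" by (simp add: r p nth_append)
    ultimately have "m = n" by (auto simp: q nth_append split: if_splits)
    with neq p q show False by simp
  qed
  ultimately show ?thesis unfolding prefix_free_machine_def by simp
qed

text \<open>The unary program of \<open>s\<close> has length \<open>str_code s + 1\<close>;
  optimality of \<open>V\<close> adds a constant.\<close>

lemma optimal_short_program:
  assumes "optimal V"
  obtains d where "\<And>s. \<exists>q. V q = Some s \<and> length q \<le> str_code s + 1 + d"
proof -
  obtain d where d: "\<forall>p\<in>dom unary_machine. \<exists>q. V q = unary_machine p \<and> length q \<le> length p + d"
    using assms unary_machine_prefix_free_machine unfolding optimal_def by blast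
  have "\<exists>q. V q = Some s \<and> length q \<le> str_code s + 1 + d" for s
    using d[rule_format, OF domI, OF unary_machine_unary[of s]] by (simp add: unary_machine_unary)
  then show ?thesis by (rule that)
qed

theorem theorem4:
  fixes V :: "bitstring \<rightharpoonup> bitstring"
  assumes "optimal V"
  shows "\<exists>W. optimal W \<and>
           (\<forall>s. complexity W s = complexity V s) \<and>
           (\<forall>s. finite (programs W s)) \<and>
           (\<exists>f. total_recursive f \<and> (\<forall>s. 0 < f s) \<and> (\<forall>s. card (programs W s) \<le> f s))"
proof -
  obtain d where d: "\<And>s. \<exists>q. V q = Some s \<and> length q \<le> str_code s + 1 + d"
    using optimal_short_program[OF assms] by blast
  \<comment> \<open>The exponent exceeds the length bound \<open>str_code s + 1 + d\<close> by one
    because strings of length l have codes below 2^(l + 1).\<close>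
  define h where "h s = (2::nat) ^ (str_code s + (d + 2))" for s
  define W where "W p = (case V p of None \<Rightarrow> None
    | Some s \<Rightarrow> if str_code p \<le> h s then Some s else None)" for p
  have W_iff: "W p = Some s \<longleftrightarrow> V p = Some s \<and> str_code p \<le> h s" for p s
    by (auto simp: W_def split: option.splits)
  have code_le_h: "str_code p \<le> h s" if "length p \<le> str_code s + 1 + d" for p s
  proof -
    have "str_code p \<le> 2 ^ Suc (length p)" using str_code_less[of p] by linarith
    also have "\<dots> \<le> h s" unfolding h_def using that by (intro power_increasing) auto
    finally show ?thesis .
  qed
  \<comment> \<open>\<open>W\<close> may drop \<open>p\<close>, but only when \<open>p\<close> is
    longer than the short program supplied by \<open>d\<close>, which \<open>W\<close>
    keeps.\<close>
  have shorter: "\<exists>q. W q = Some s \<and> length q \<le> length p" if "V p = Some s" for p s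
  proof (cases "length p \<le> str_code s + 1 + d")
    case True
    with that show ?thesis using code_le_h W_iff by blast
  next
    case False
    obtain q where q: "V q = Some s" "length q \<le> str_code s + 1 + d" using d by blast
    with False have "length q \<le> length p" by linarith
    with q show ?thesis using code_le_h W_iff by blast
  qed
  have "partial_recursive W"
    using assms partial_recursive_restrict_pow2[of V "d + 2"]
    unfolding W_def h_def optimal_def prefix_free_machine_def by simp
  moreover have "prefix_free (dom W)"
  proof -
    have "dom W \<subseteq> dom V" using W_iff by blast
    moreover have "prefix_free (dom V)"
      using assms unfolding optimal_def prefix_free_machine_def by simp
    ultimately show ?thesis
      unfolding prefix_free_def by (simp add: subset_iff)
  qed
  moreover have "\<exists>d. \<forall>p\<in>dom C. \<exists>q. W q = C p \<and> length q \<le> length p + d"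
    if C: "prefix_free_machine C" for C
  proof -
    obtain e where "\<forall>p\<in>dom C. \<exists>q. V q = C p \<and> length q \<le> length p + e"
      using assms C unfolding optimal_def by blast
    then have "\<forall>p\<in>dom C. \<exists>q. W q = C p \<and> length q \<le> length p + e"
      using shorter by (metis domD le_trans)
    then show ?thesis ..
  qed
  ultimately have "optimal W"
    unfolding optimal_def prefix_free_machine_def by blast
  moreover have "complexity W s = complexity V s" for s
  proof (rule antisym)
    show "complexity W s \<le> complexity V s"
      unfolding complexity_def using shorter by (intro Inf_mono) fastforce
    show "complexity V s \<le> complexity W s"
      unfolding complexity_def using W_iff by (intro Inf_superset_mono) blast
  qed
  \<comment> \<open>\<open>str_code\<close> is injective, and the codes from 0 to \<open>h s\<close>
    number \<open>Suc (h s)\<close>.\<close>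
  moreover have "finite (programs W s) \<and> card (programs W s) \<le> Suc (h s)" for s
  proof -
    have sub: "str_code ` programs W s \<subseteq> {..h s}"
      using W_iff by (auto simp: programs_def)
    have inj: "inj_on str_code (programs W s)"
      using bij_is_inj[OF bij_str_code] by (rule inj_on_subset) simp
    show ?thesis
      using inj_on_finite[OF inj sub] card_inj_on_le[OF inj sub] by simp
  qed
  moreover have "total_recursive (\<lambda>s. Suc (h s))"
    unfolding h_def by (rule total_recursive_Suc_pow2)
  ultimately show ?thesis by blast
qed

end
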